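(* Let $k\ge 2$ and let $\{S_n\}_{n\ge 0}\subset\mathsf{Aut}_0(\mathbb{C}^k)$ be a sequence satisfying the uniform upper-bound condition at the origin. Then $\Omega_{\{S_n\}}$ satisfies the following properties: (i) $\Omega_{\{S_n\}}$ is a connected open set in $\mathbb{C}^k$. (ii) There exists $r_0>0$ such that for every $0<r\le r_0$, setting $\Omega_n^S=S(n)^{-1}(B^k(0;r))$, one has $\Omega_n^S\subset\Omega_{n+1}^S$ for every $n\ge 0$ and $$\Omega_{\{S_n\}}=\bigcup_{n\ge 0}\Omega_n^S.$$ (iii) The infinitesimal Kobayashi metric vanishes identically on $\Omega_{\{S_n\}}$.
   Context: $\mathsf{Aut}_0(\mathbb{C}^k)$ denotes the group of (holomorphic) automorphisms of $\mathbb{C}^k$ fixing the origin, and $B^k(p;r)$ is the ball of radius $r$ centered at $p$ in $\mathbb{C}^k$. For a sequence $\{S_n\}_{n\ge 0}\subset \mathsf{Aut}_0(\mathbb{C}^k)$ put $S(n)=S_n\circ\cdots\circ S_0$; the (non-autonomous) basin of attraction at the origin is $\Omega_{\{S_n\}}=\{z\in\mathbb{C}^k: S(n)(z)\to 0 \text{ as } n\to\infty\}$. A sequence $\{S_n\}\subset\mathsf{Aut}_0(\mathbb{C}^k)$ satisfies the uniform upper-bound condition at the origin if there exist $r>0$ and $0<C<1$ such that $\|S_n(z)\|\le C\|z\|$ for every $z\in B^k(0;r)$ and every $n\ge 0$. *)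

theory Defs
  imports "HOL-Complex_Analysis.Complex_Analysis"
begin

text \<open>
  The space \<open>C\<^sup>k\<close> is the type \<open>complex ^ 'k\<close>; its norm is the Euclidean (Hermitian) norm, so
  \<open>ball p r\<close> is \<open>B\<^sup>k(p; r)\<close>. The symbol \<open>*s\<close> denotes multiplication by complex scalars.
\<close>

text \<open>Holomorphic on an open set: Frechet differentiable with complex-linear derivative.\<close>

definition holomorphic_map_on ::
    "(complex ^ 'm \<Rightarrow> complex ^ 'n) \<Rightarrow> (complex ^ 'm) set \<Rightarrow> bool" where
  "holomorphic_map_on f U \<longleftrightarrow>
     (\<forall>z\<in>U. \<exists>f'. (f has_derivative f') (at z) \<and> Vector_Spaces.linear (*s) (*s) f')"

definition Aut0 :: "(complex ^ 'k \<Rightarrow> complex ^ 'k) set" where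
  "Aut0 = {f. bij f \<and> holomorphic_map_on f UNIV \<and> holomorphic_map_on (inv f) UNIV \<and> f 0 = 0}"

primrec iter_comp :: "(nat \<Rightarrow> 'a \<Rightarrow> 'a) \<Rightarrow> nat \<Rightarrow> 'a \<Rightarrow> 'a" where
  "iter_comp S 0 = S 0"
| "iter_comp S (Suc n) = S (Suc n) \<circ> iter_comp S n"

definition basin :: "(nat \<Rightarrow> complex ^ 'k \<Rightarrow> complex ^ 'k) \<Rightarrow> (complex ^ 'k) set" where
  "basin S = {z. (\<lambda>n. iter_comp S n z) \<longlonglongrightarrow> 0}"

definition uniform_upper_bound :: "(nat \<Rightarrow> complex ^ 'k \<Rightarrow> complex ^ 'k) \<Rightarrow> bool" where
  "uniform_upper_bound S \<longleftrightarrow>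
     (\<exists>r>0. \<exists>C. 0 < C \<and> C < 1 \<and> (\<forall>n. \<forall>z\<in>ball 0 r. norm (S n z) \<le> C * norm z))"

definition holomorphic_discs :: "(complex ^ 'k) set \<Rightarrow> (complex \<Rightarrow> complex ^ 'k) set" where
  "holomorphic_discs \<Omega> =
     {\<phi>. (\<forall>i. (\<lambda>\<zeta>. \<phi> \<zeta> $ i) holomorphic_on ball 0 1) \<and> \<phi> ` ball 0 1 \<subseteq> \<Omega>}"

definition disc_deriv :: "(complex \<Rightarrow> complex ^ 'k) \<Rightarrow> complex \<Rightarrow> complex ^ 'k" where
  "disc_deriv \<phi> \<zeta> = (\<chi> i. deriv (\<lambda>w. \<phi> w $ i) \<zeta>)"

text \<open>
  The infinitesimal Kobayashi (Kobayashi--Royden) metric of \<open>\<Omega>\<close> at the point \<open>p\<close> and the tangent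
  vector \<open>v\<close>. It is \<open>ennreal\<close>-valued so that the infimum of the empty set is \<open>\<infinity>\<close>; for open \<open>\<Omega>\<close>
  and \<open>p \<in> \<Omega>\<close> the set is nonempty and the value finite.
\<close>

definition kobayashi_metric ::
    "(complex ^ 'k) set \<Rightarrow> complex ^ 'k \<Rightarrow> complex ^ 'k \<Rightarrow> ennreal" where
  "kobayashi_metric \<Omega> p v =
     Inf {ennreal (cmod \<alpha>) |\<alpha>. \<exists>\<phi>\<in>holomorphic_discs \<Omega>. \<phi> 0 = p \<and> \<alpha> *s disc_deriv \<phi> 0 = v}"

end

theory Submission
  imports Defs
begin

text \<open>
  Once an orbit enters the ball on which all \<open>S n\<close> contract by \<open>C\<close>, it stays there and tends to
  \<open>0\<close>; this gives the exhaustion by preimages of balls, hence openness and connectedness. For the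
  Kobayashi metric at \<open>p\<close>, the maps \<open>S(n)\<close> tend uniformly to \<open>0\<close> on a neighbourhood of \<open>p\<close>, so by
  Cauchy's estimate \<open>dS(n)\<^sub>p v\<close> tends to \<open>0\<close>. Hence, for any \<open>a > 0\<close> and large \<open>n\<close>, the
  disc \<open>\<zeta> \<mapsto> S(n)(p) + \<zeta> a dS(n)\<^sub>p v\<close> lies in the small ball, and its pullback under \<open>S(n)\<close>
  is a disc in the basin through \<open>p\<close> with derivative \<open>a v\<close>.
\<close>

lemma norm_vector_smult: "norm (c *s (x :: complex ^ 'n)) = cmod c * norm x"
  by (simp add: norm_vec_def norm_mult L2_set_right_distrib)

lemma holomorphic_map_on_frechet_derivative:
  assumes "holomorphic_map_on f U" "z \<in> U"
  shows "(f has_derivative frechet_derivative f (at z)) (at z)"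
    and "Vector_Spaces.linear (*s) (*s) (frechet_derivative f (at z))"
  using assms frechet_derivative_at unfolding holomorphic_map_on_def by metis+

lemma holomorphic_map_on_compose:
  assumes "holomorphic_map_on f U" "holomorphic_map_on g V" "f ` U \<subseteq> V"
  shows "holomorphic_map_on (g \<circ> f) U"
  unfolding holomorphic_map_on_def
proof
  fix z assume "z \<in> U"
  then obtain f' g' where
      "(f has_derivative f') (at z)" "Vector_Spaces.linear (*s) (*s) f'"
      "(g has_derivative g') (at (f z))" "Vector_Spaces.linear (*s) (*s) g'"
    using assms unfolding holomorphic_map_on_def by blast
  then show "\<exists>h'. ((g \<circ> f) has_derivative h') (at z) \<and> Vector_Spaces.linear (*s) (*s) h'"
    using diff_chain_at Vector_Spaces.linear_compose by blast
qed

lemma holomorphic_map_on_imp_continuous_on: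
  "holomorphic_map_on f U \<Longrightarrow> continuous_on U f"
  unfolding holomorphic_map_on_def
  by (meson continuous_at_imp_continuous_on has_derivative_continuous)

text \<open>Restricting to a complex line reduces matters to one variable: complex linearity of the
  Frechet derivative turns it into multiplication by a complex number. This serves both the Cauchy
  estimate and the derivative of pulled-back discs.\<close>

lemma holomorphic_map_on_line_has_field_derivative:
  assumes "holomorphic_map_on f UNIV"
  shows "((\<lambda>\<zeta>. f (q + \<zeta> *s w) $ i) has_field_derivative
           frechet_derivative f (at (q + \<zeta> *s w)) w $ i) (at \<zeta>)"
proof -
  let ?f' = "frechet_derivative f (at (q + \<zeta> *s w))"
  note f' = holomorphic_map_on_frechet_derivative[OF assms UNIV_I, of "q + \<zeta> *s w"]
  have "linear (\<lambda>\<zeta>. \<zeta> *s w)"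
    by (rule linearI) (auto simp: vec_eq_iff algebra_simps)
  then have "((\<lambda>\<zeta>. \<zeta> *s w) has_derivative (\<lambda>\<zeta>. \<zeta> *s w)) (at \<zeta>)"
    by (simp add: bounded_linear_imp_has_derivative linear_conv_bounded_linear)
  then have "((\<lambda>\<zeta>. q + \<zeta> *s w) has_derivative (\<lambda>\<zeta>. \<zeta> *s w)) (at \<zeta>)"
    using has_derivative_add[OF has_derivative_const] by fastforce
  from bounded_linear.has_derivative[OF bounded_linear_vec_nth
      has_derivative_compose[OF this f'(1)]]
  have "((\<lambda>\<zeta>. f (q + \<zeta> *s w) $ i) has_derivative (\<lambda>\<zeta>. ?f' (\<zeta> *s w) $ i)) (at \<zeta>)" .
  moreover have "?f' (c *s w) $ i = (?f' w $ i) * c" for c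
    using vec.linear_scale[OF f'(2)] by (simp add: mult.commute)
  ultimately show ?thesis
    by (simp add: has_field_derivative_def)
qed

lemma Aut0_compose:
  assumes "f \<in> Aut0" "g \<in> Aut0"
  shows "g \<circ> f \<in> Aut0"
  using assms unfolding Aut0_def
  by (auto simp: bij_comp o_inv_distrib intro!: holomorphic_map_on_compose[where V = UNIV])

lemma iter_comp_Aut0:
  assumes "\<And>n. S n \<in> Aut0"
  shows "iter_comp S n \<in> Aut0"
  by (induction n) (use assms in \<open>auto intro: Aut0_compose simp del: o_apply\<close>)

text \<open>As \<open>C < 1\<close>, an orbit point inside the ball has its image inside too, so the
  one-step bound applies again and the factors \<open>C\<close> multiply.\<close>

lemma iter_comp_contraction:
  assumes S: "\<And>n z. norm z < r \<Longrightarrow> norm (S n z) \<le> C * norm z"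
    and C: "0 < C" "C < 1" and z: "norm (iter_comp S n z) < r"
  shows "norm (iter_comp S (n + m) z) \<le> C ^ m * norm (iter_comp S n z)"
proof (induction m)
  case (Suc m)
  \<comment> \<open>With the induction hypothesis this keeps the orbit at time \<open>n + m\<close>
    in the ball, where the bound on \<open>S\<close> is available.\<close>
  have "C ^ m * norm (iter_comp S n z) \<le> norm (iter_comp S n z)"
    using C by (simp add: mult_left_le_one_le power_le_one)
  then have "norm (iter_comp S (n + Suc m) z) \<le> C * norm (iter_comp S (n + m) z)"
    using S Suc z by simp
  also have "\<dots> \<le> C * (C ^ m * norm (iter_comp S n z))"
    using C Suc by (intro mult_left_mono) auto
  finally show ?case by simp
qed simp

lemma basin_eq_Union_vimage:
  fixes S :: "nat \<Rightarrow> complex ^ 'k \<Rightarrow> complex ^ 'k"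
  assumes S: "\<And>n z. norm z < r \<Longrightarrow> norm (S n z) \<le> C * norm z"
    and C: "0 < C" "C < 1" and "0 < r"
  shows "basin S = (\<Union>n. iter_comp S n -` ball 0 r)"
proof (intro set_eqI iffI)
  fix z assume "z \<in> basin S"
  then have "(\<lambda>n. iter_comp S n z) \<longlonglongrightarrow> 0"
    by (simp add: basin_def)
  then obtain n where "norm (iter_comp S n z) < r"
    using LIMSEQ_D[OF _ \<open>0 < r\<close>] by fastforce
  then show "z \<in> (\<Union>n. iter_comp S n -` ball 0 r)"
    by auto
next
  fix z assume "z \<in> (\<Union>n. iter_comp S n -` ball 0 r)"
  then obtain n where n: "norm (iter_comp S n z) < r" by auto
  have "(\<lambda>m. C ^ m * norm (iter_comp S n z)) \<longlonglongrightarrow> 0"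
    using C by (intro tendsto_mult_left_zero LIMSEQ_power_zero) auto
  then have "(\<lambda>m. iter_comp S (n + m) z) \<longlonglongrightarrow> 0"
    by (rule Lim_null_comparison[rotated])
       (use iter_comp_contraction[of r S C, OF S C n] in auto)
  then have "(\<lambda>m. iter_comp S (m + n) z) \<longlonglongrightarrow> 0"
    by (simp add: add.commute)
  then show "z \<in> basin S"
    unfolding basin_def by (simp add: LIMSEQ_offset)
qed

lemma Aut0_vimage_ball:
  assumes "f \<in> Aut0"
  shows "open (f -` ball 0 r)" and "connected (f -` ball 0 r)"
proof -
  have f: "bij f" "holomorphic_map_on f UNIV" "holomorphic_map_on (inv f) UNIV"
    using assms by (auto simp: Aut0_def)
  show "open (f -` ball 0 r)"
    using f(2) holomorphic_map_on_imp_continuous_on open_vimage by blast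
  \<comment> \<open>Connectedness passes to images under continuous maps, not to preimages, so the
    preimage is rewritten as an image under the inverse automorphism.\<close>
  have "f -` ball 0 r = inv f ` ball 0 r"
    using f(1) by (rule bij_vimage_eq_inv_image)
  then show "connected (f -` ball 0 r)"
    using f(3) by (metis connected_ball connected_continuous_image continuous_on_subset
        holomorphic_map_on_imp_continuous_on subset_UNIV)
qed

text \<open>Cauchy's estimate is applied to each component along the complex line through
  \<open>p\<close> in direction \<open>v\<close>. The radius \<open>e\<close> of the disc does not
  depend on \<open>n\<close>, so the derivatives are bounded by \<open>b n / e\<close>.\<close>

lemma frechet_derivative_tendsto_0:
  fixes F :: "nat \<Rightarrow> complex ^ 'm \<Rightarrow> complex ^ 'n"
  assumes F: "\<And>n. holomorphic_map_on (F n) UNIV"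
    and "0 < d" and b: "b \<longlonglongrightarrow> 0"
    and bound: "\<And>n z. dist p z < d \<Longrightarrow> norm (F n z) \<le> b n"
  shows "(\<lambda>n. frechet_derivative (F n) (at p) v) \<longlonglongrightarrow> 0"
proof (rule vec_tendstoI)
  fix i
  obtain e where e: "e > 0" "\<And>\<zeta>. cmod \<zeta> \<le> e \<Longrightarrow> norm (\<zeta> *s v) < d"
  proof
    \<comment> \<open>The summand \<open>1\<close> covers \<open>v = 0\<close>; halving
      \<open>d\<close> gives the strict inequality on the closed disc of radius
      \<open>e\<close>.\<close>
    define e where "e = d / 2 / (norm v + 1)"
    show e0: "e > 0"
      using \<open>0 < d\<close> by (simp add: e_def add_nonneg_pos)
    show "norm (\<zeta> *s v) < d" if "cmod \<zeta> \<le> e" for \<zeta>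
    proof -
      have "norm (\<zeta> *s v) = cmod \<zeta> * norm v"
        by (rule norm_vector_smult)
      also have "\<dots> \<le> e * (norm v + 1)"
        using that e0 by (intro mult_mono) auto
      also have "\<dots> = d / 2"
        by (rule nonzero_eq_divide_eq[THEN iffD1, OF _ e_def]) (smt (verit) norm_ge_zero)
      finally show ?thesis using \<open>0 < d\<close> by simp
    qed
  qed
  have le: "cmod (frechet_derivative (F n) (at p) v $ i) \<le> b n / e" for n
  proof -
    let ?g = "\<lambda>\<zeta>. F n (p + \<zeta> *s v) $ i"
    have g': "(?g has_field_derivative frechet_derivative (F n) (at (p + \<zeta> *s v)) v $ i) (at \<zeta>)" for \<zeta>
      by (rule holomorphic_map_on_line_has_field_derivative[OF F])
    then have g: "?g holomorphic_on UNIV"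
      by (auto simp: holomorphic_on_open)
    have "cmod ((deriv ^^ 1) ?g 0) \<le> fact 1 * b n / e ^ 1"
    proof (rule Cauchy_inequality)
      show "?g holomorphic_on ball 0 e" "continuous_on (cball 0 e) ?g"
        using g by (auto intro: holomorphic_on_subset holomorphic_on_imp_continuous_on)
      show "cmod (?g \<zeta>) \<le> b n" if "norm (0 - \<zeta>) = e" for \<zeta>
      proof -
        have "norm (F n (p + \<zeta> *s v)) \<le> b n"
          using that by (intro bound) (simp add: dist_norm e(2))
        then show ?thesis
          by (rule order_trans[OF Finite_Cartesian_Product.norm_nth_le])
      qed
    qed fact
    then show ?thesis
      using DERIV_imp_deriv[OF g'[of 0]] by simp
  qed
  have "(\<lambda>n. frechet_derivative (F n) (at p) v $ i) \<longlonglongrightarrow> 0"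
    by (rule Lim_null_comparison[OF _ tendsto_divide_zero[OF b, of e]]) (simp add: le)
  then show "(\<lambda>n. frechet_derivative (F n) (at p) v $ i) \<longlonglongrightarrow> 0 $ i"
    by simp
qed

text \<open>The affine disc through \<open>F p\<close> with velocity \<open>a\<close> times the
  image of \<open>v\<close> stays in the ball by \<open>small\<close>. Its pullback under
  \<open>F\<close> passes through \<open>p\<close> with velocity \<open>a *s v\<close>, making
  \<open>1 / a\<close> a competitor in the infimum.\<close>

lemma kobayashi_metric_le_pullback:
  fixes F :: "complex ^ 'k \<Rightarrow> complex ^ 'k"
  assumes F: "F \<in> Aut0" and sub: "F -` ball 0 r \<subseteq> \<Omega>" and "a > 0"
    and small: "norm (F p) + a * norm (frechet_derivative F (at p) v) < r"
  shows "kobayashi_metric \<Omega> p v \<le> ennreal (1 / a)"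
proof -
  define w where "w = of_real a *s frechet_derivative F (at p) v"
  define \<phi> where "\<phi> \<zeta> = inv F (F p + \<zeta> *s w)" for \<zeta>
  have bij: "bij F" and hol: "holomorphic_map_on F UNIV" "holomorphic_map_on (inv F) UNIV"
    using F by (auto simp: Aut0_def)
  let ?F' = "frechet_derivative F (at p)" and ?G' = "frechet_derivative (inv F) (at (F p))"
  note F' = holomorphic_map_on_frechet_derivative[OF hol(1) UNIV_I, of p]
  note G' = holomorphic_map_on_frechet_derivative[OF hol(2) UNIV_I, of "F p"]
  \<comment> \<open>The chain rule for this identity shows that \<open>?G'\<close> undoes
    \<open>?F'\<close>, so pulling back \<open>w\<close> recovers a multiple of
    \<open>v\<close>.\<close>
  have "inv F \<circ> F = id"
    using bij by (simp add: bij_is_inj)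
  then have "(id has_derivative ?G' \<circ> ?F') (at p)"
    using diff_chain_at[OF F'(1) G'(1)] by simp
  then have "?G' \<circ> ?F' = id"
    using has_derivative_unique has_derivative_id by blast
  then have "?G' (?F' v) = v" by (metis comp_apply id_apply)
  then have G'w: "?G' w = of_real a *s v"
    unfolding w_def using vec.linear_scale[OF G'(2)] by metis
  have \<phi>': "((\<lambda>\<zeta>. \<phi> \<zeta> $ i) has_field_derivative
      frechet_derivative (inv F) (at (F p + \<zeta> *s w)) w $ i) (at \<zeta>)" for i \<zeta>
    unfolding \<phi>_def by (rule holomorphic_map_on_line_has_field_derivative[OF hol(2)])
  have "\<phi> \<zeta> \<in> \<Omega>" if "\<zeta> \<in> ball 0 1" for \<zeta>
  proof -
    have "cmod \<zeta> * norm w \<le> norm w"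
      using that by (simp add: mult_left_le_one_le)
    then have "norm (F p + \<zeta> *s w) \<le> norm (F p) + norm w"
      using norm_triangle_ineq[of "F p" "\<zeta> *s w"] by (simp add: norm_vector_smult)
    also have "\<dots> < r"
      using small \<open>a > 0\<close> by (simp add: w_def norm_vector_smult)
    finally have "F (\<phi> \<zeta>) \<in> ball 0 r"
      using bij by (simp add: \<phi>_def bij_is_surj surj_f_inv_f)
    then show ?thesis using sub by auto
  qed
  moreover have "(\<lambda>\<zeta>. \<phi> \<zeta> $ i) holomorphic_on ball 0 1" for i
    using \<phi>' by (auto simp: holomorphic_on_open)
  ultimately have "\<phi> \<in> holomorphic_discs \<Omega>"
    by (auto simp: holomorphic_discs_def)
  moreover have "\<phi> 0 = p"
    using bij by (simp add: \<phi>_def bij_is_inj)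
  moreover have "disc_deriv \<phi> 0 = of_real a *s v"
    using DERIV_imp_deriv[OF \<phi>'[of _ 0]] G'w by (simp add: disc_deriv_def vec_eq_iff)
  then have "of_real (1 / a) *s disc_deriv \<phi> 0 = v"
    using \<open>a > 0\<close> by (simp add: vec_eq_iff)
  moreover have "cmod (of_real (1 / a)) = 1 / a"
    using \<open>a > 0\<close> by (simp add: norm_divide)
  ultimately show ?thesis
    unfolding kobayashi_metric_def
    by (intro Inf_lower) (metis (mono_tags, lifting) mem_Collect_eq)
qed

theorem proposition3p6:
  fixes S :: "nat \<Rightarrow> complex ^ 'k \<Rightarrow> complex ^ 'k"
  assumes "CARD('k) \<ge> 2"
    and "\<And>n. S n \<in> Aut0"
    and "uniform_upper_bound S"
  shows "(open (basin S) \<and> connected (basin S)) \<and>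
         (\<exists>r0>0. \<forall>r. 0 < r \<and> r \<le> r0 \<longrightarrow>
           (\<forall>n. iter_comp S n -` ball 0 r \<subseteq> iter_comp S (Suc n) -` ball 0 r) \<and>
           basin S = (\<Union>n. iter_comp S n -` ball 0 r)) \<and>
         (\<forall>p\<in>basin S. \<forall>v. kobayashi_metric (basin S) p v = 0)"
proof -
  obtain r0 C where "r0 > 0" and C: "0 < C" "C < 1"
    and S: "\<And>n z. norm z < r0 \<Longrightarrow> norm (S n z) \<le> C * norm z"
    using assms(3) unfolding uniform_upper_bound_def by auto
  let ?F = "iter_comp S"
  have F: "?F n \<in> Aut0" for n
    using iter_comp_Aut0 assms(2) by blast
  have basin: "basin S = (\<Union>n. ?F n -` ball 0 r)" if "0 < r" "r \<le> r0" for r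
    using basin_eq_Union_vimage[of r S C] S C that by simp
  have mono: "?F n -` ball 0 r \<subseteq> ?F (Suc n) -` ball 0 r" if "0 < r" "r \<le> r0" for n r
  proof
    fix z assume "z \<in> ?F n -` ball 0 r"
    then have z: "norm (?F n z) < r" by simp
    have "norm (?F (Suc n) z) \<le> C * norm (?F n z)"
      using S z that by simp
    also have "\<dots> \<le> norm (?F n z)"
      using C by (simp add: mult_left_le_one_le)
    finally show "z \<in> ?F (Suc n) -` ball 0 r"
      using z by simp
  qed
  have "open (basin S)"
    using basin[OF \<open>r0 > 0\<close>] Aut0_vimage_ball(1)[OF F] by auto
  moreover have "connected (basin S)"
  proof -
    \<comment> \<open>The origin is a common point of all the connected preimages, which makes their
      union connected.\<close>
    have "0 \<in> ?F n -` ball 0 r0" for n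
      using F[of n] \<open>r0 > 0\<close> by (simp add: Aut0_def)
    then have "(\<Inter>n. ?F n -` ball 0 r0) \<noteq> {}"
      by blast
    then show ?thesis
      unfolding basin[OF \<open>r0 > 0\<close> order_refl]
      by (intro connected_Union) (auto intro: Aut0_vimage_ball(2)[OF F])
  qed
  moreover have "kobayashi_metric (basin S) p v = 0" if p: "p \<in> basin S" for p v
  proof -
    obtain N where "p \<in> ?F N -` ball 0 r0"
      using p basin[OF \<open>r0 > 0\<close>] by auto
    then obtain d where "d > 0" and d: "ball p d \<subseteq> ?F N -` ball 0 r0"
      using Aut0_vimage_ball(1)[OF F] open_contains_ball by blast
    \<comment> \<open>From time \<open>N\<close> on, the whole neighbourhood \<open>ball p d\<close>
      contracts geometrically, with the uniform bound \<open>C ^ m * r0\<close>.\<close>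
    have "(\<lambda>m. frechet_derivative (?F (N + m)) (at p) v) \<longlonglongrightarrow> 0"
    proof (rule frechet_derivative_tendsto_0)
      show "holomorphic_map_on (?F (N + n)) UNIV" for n
        using F by (simp add: Aut0_def)
      show "(\<lambda>m. C ^ m * r0) \<longlonglongrightarrow> 0"
        using C by (intro tendsto_mult_left_zero LIMSEQ_power_zero) auto
      show "norm (?F (N + m) z) \<le> C ^ m * r0" if "dist p z < d" for m z
      proof -
        have z: "norm (?F N z) < r0" using that d by auto
        have "norm (?F (N + m) z) \<le> C ^ m * norm (?F N z)"
          using iter_comp_contraction[of r0 S C, OF S C z] by simp
        also have "\<dots> \<le> C ^ m * r0"
          using z C by (intro mult_left_mono) auto
        finally show ?thesis .
      qed
    qed fact
    moreover have "(\<lambda>m. ?F (N + m) p) \<longlonglongrightarrow> 0"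
    proof -
      have "(\<lambda>n. ?F n p) \<longlonglongrightarrow> 0" using p by (simp add: basin_def)
      from LIMSEQ_ignore_initial_segment[OF this, of N] show ?thesis
        by (simp add: add.commute)
    qed
    ultimately have lim: "(\<lambda>m. norm (?F (N + m) p)
        + a * norm (frechet_derivative (?F (N + m)) (at p) v)) \<longlonglongrightarrow> 0" for a
      by (intro tendsto_add_zero tendsto_mult_right_zero tendsto_norm_zero)
    have "kobayashi_metric (basin S) p v \<le> 0"
    proof (rule ennreal_le_epsilon)
      fix e :: real assume "e > 0"
      \<comment> \<open>The scale \<open>a = 1 / e\<close> is fixed first and \<open>m\<close> is
        chosen afterwards, so that the pullback estimate yields exactly
        \<open>1 / a = e\<close>.\<close>
      obtain m where "norm (?F (N + m) p)
          + 1 / e * norm (frechet_derivative (?F (N + m)) (at p) v) < r0"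
        using order_tendstoD(2)[OF lim \<open>r0 > 0\<close>] eventually_happens'[OF sequentially_bot] by blast
      moreover have "?F (N + m) -` ball 0 r0 \<subseteq> basin S"
        using basin[OF \<open>r0 > 0\<close>] by blast
      ultimately show "kobayashi_metric (basin S) p v \<le> 0 + ennreal e"
        using kobayashi_metric_le_pullback[OF F, of "N + m" r0 "basin S" "1 / e" p v] \<open>e > 0\<close>
        by simp
    qed
    then show ?thesis by simp
  qed
  ultimately show ?thesis
    using \<open>r0 > 0\<close> basin mono by (intro conjI exI[of _ r0] allI ballI impI) simp_all
qed

end
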